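(* Let $G$ be a graph of order $n\ge 2$ and maximum degree $\Delta$. Then $$\gamma_{MR}(G)\ge \frac{n(2-\Delta)}{\Delta+1}.$$
   Context: All graphs are finite and simple. For a vertex $v$ of $G=(V,E)$, $N[v]=\{v\}\cup\{u: uv\in E\}$ is the closed neighborhood, and for $f:V\to\mathbb{R}$ and $S\subseteq V$, $f(S)=\sum_{x\in S}f(x)$. A majority Roman dominating function (MRDF) on $G$ is a function $f:V\to\{-1,1,2\}$ such that (i) $f(N[v])\ge 1$ for at least half of the vertices $v\in V$, and (ii) every vertex $u$ with $f(u)=-1$ is adjacent to at least one vertex $w$ with $f(w)=2$. The weight of $f$ is $f(V)$, and the majority Roman domination number $\gamma_{MR}(G)$ is the minimum weight of an MRDF on $G$.
   Formalization: The formal statement adds the hypothesis Δ ≥ 1 (G has at least one edge); for an edgeless graph Δ = 0 and γ_MR(G) = n, while the claimed lower bound is 2n, so the statement fails for every such graph. *)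

theory Defs
  imports Complex_Main "Graph_Theory.Digraph"
begin

text \<open>
  Finite simple graphs are the locale \<^locale>\<open>graph\<close>: finite, loop-free, symmetric digraphs
  without parallel arcs. An undirected edge is a pair of opposite arcs, so the degree of a
  vertex is its out-degree.
\<close>

definition closed_nbhd :: "('a, 'b) pre_digraph \<Rightarrow> 'a \<Rightarrow> 'a set" where
  "closed_nbhd G v = {v} \<union> {u. u \<rightarrow>\<^bsub>G\<^esub> v}"

definition max_degree :: "('a, 'b) pre_digraph \<Rightarrow> nat" where
  "max_degree G = Max (out_degree G ` verts G)"

text \<open>Functions on the vertex set are total functions; values outside \<^term>\<open>verts G\<close> are irrelevant.\<close>

definition MRDF :: "('a, 'b) pre_digraph \<Rightarrow> ('a \<Rightarrow> int) \<Rightarrow> bool" where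
  "MRDF G f \<longleftrightarrow>
     (\<forall>v \<in> verts G. f v \<in> {-1, 1, 2}) \<and>
     real (card {v \<in> verts G. sum f (closed_nbhd G v) \<ge> 1}) \<ge> real (card (verts G)) / 2 \<and>
     (\<forall>u \<in> verts G. f u = -1 \<longrightarrow> (\<exists>w. u \<rightarrow>\<^bsub>G\<^esub> w \<and> f w = 2))"

definition MRDF_weights :: "('a, 'b) pre_digraph \<Rightarrow> int set" where
  "MRDF_weights G = {sum f (verts G) | f. MRDF G f}"

definition gamma_MR :: "('a, 'b) pre_digraph \<Rightarrow> int" where
  "gamma_MR G = Min (MRDF_weights G)"

text \<open>The minimum in \<^const>\<open>gamma_MR\<close> ranges over a finite nonempty set.\<close>

lemma finite_MRDF_weights:
  assumes "finite (verts G)"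
  shows "finite (MRDF_weights G)"
proof -
  have "sum f (verts G) \<in> {- int (card (verts G)) .. 2 * int (card (verts G))}"
    if "MRDF G f" for f
  proof -
    have *: "-1 \<le> f v \<and> f v \<le> 2" if "v \<in> verts G" for v
      using \<open>MRDF G f\<close> that unfolding MRDF_def by fastforce
    have "sum f (verts G) \<ge> of_nat (card (verts G)) * (-1)"
      by (rule sum_bounded_below) (use * in auto)
    moreover have "sum f (verts G) \<le> of_nat (card (verts G)) * 2"
      by (rule sum_bounded_above) (use * in auto)
    ultimately show ?thesis by simp
  qed
  then have "MRDF_weights G \<subseteq> {- int (card (verts G)) .. 2 * int (card (verts G))}"
    unfolding MRDF_weights_def by blast
  then show ?thesis by (rule finite_subset) simp
qed

lemma MRDF_const_1:
  assumes "graph G"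
  shows "MRDF G (\<lambda>_. 1)"
proof -
  interpret graph G by fact
  have "finite (closed_nbhd G v)" for v
  proof (rule finite_subset)
    show "closed_nbhd G v \<subseteq> insert v (verts G)"
      unfolding closed_nbhd_def arcs_ends_conv by auto
  qed simp
  then have "sum (\<lambda>_. 1::int) (closed_nbhd G v) \<ge> 1" for v
    by (simp add: Suc_le_eq card_gt_0_iff) (simp add: closed_nbhd_def)
  then show ?thesis unfolding MRDF_def by simp
qed

lemma MRDF_weights_nonempty:
  assumes "graph G"
  shows "MRDF_weights G \<noteq> {}"
  using MRDF_const_1[OF assms] unfolding MRDF_weights_def by blast

text \<open>
  An edgeless graph of order \<open>n\<close> has \<open>\<Delta> = 0\<close> and \<open>\<gamma>\<^sub>M\<^sub>R = n\<close>, whereas \<open>n (2 - \<Delta>) / (\<Delta> + 1)\<close>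
  is then \<open>2 n\<close>. The lower bound therefore requires \<open>\<Delta> \<ge> 1\<close>.
\<close>

lemma edgeless_violates_bound:
  assumes "graph G" and "verts G \<noteq> {}" and "max_degree G = 0"
  shows "gamma_MR G = int (card (verts G))"
    and "\<not> real_of_int (gamma_MR G) \<ge>
      real (card (verts G)) * (2 - real (max_degree G)) / (real (max_degree G) + 1)"
proof -
  interpret graph G by fact
  have no_arc: "\<not> u \<rightarrow>\<^bsub>G\<^esub> w" for u w
  proof
    assume "u \<rightarrow>\<^bsub>G\<^esub> w"
    then obtain e where e: "e \<in> arcs G" "tail G e = u" by (auto simp: arcs_ends_conv)
    then have u: "u \<in> verts G" by auto
    then have "out_degree G u \<le> max_degree G" unfolding max_degree_def by simp
    then have "card (out_arcs G u) = 0" using assms(3) by (simp add: out_degree_def)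
    moreover have "finite (out_arcs G u)" by (simp add: out_arcs_def)
    moreover have "e \<in> out_arcs G u" using e by (simp add: out_arcs_def)
    ultimately show False by auto
  qed
  have "int (card (verts G)) \<le> sum f (verts G)" if "MRDF G f" for f
  proof -
    have "f v \<ge> 1" if "v \<in> verts G" for v
      using \<open>MRDF G f\<close> that no_arc unfolding MRDF_def by fastforce
    then have "sum f (verts G) \<ge> of_nat (card (verts G)) * 1" by (rule sum_bounded_below)
    then show ?thesis by simp
  qed
  moreover have "int (card (verts G)) \<in> MRDF_weights G"
    using MRDF_const_1[OF assms(1)] unfolding MRDF_weights_def by force
  ultimately show 1: "gamma_MR G = int (card (verts G))"
    unfolding gamma_MR_def
    by (intro Min_eqI finite_MRDF_weights) (auto simp: MRDF_weights_def)
  have "card (verts G) > 0" using assms(2) by (simp add: card_gt_0_iff)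
  then show "\<not> real_of_int (gamma_MR G) \<ge>
      real (card (verts G)) * (2 - real (max_degree G)) / (real (max_degree G) + 1)"
    using 1 assms(3) by simp
qed

end

theory Submission
  imports Defs
begin

text \<open>
  Let \<open>M\<close> and \<open>P\<close> be the sets of vertices of value \<open>-1\<close> and \<open>2\<close>. By condition (ii) of an MRDF,
  every vertex of \<open>M\<close> has a neighbour in \<open>P\<close>, so \<open>|M| \<le> \<Delta> |P|\<close>. Vertices of value
  \<open>-1\<close>, \<open>1\<close>, \<open>2\<close> contribute \<open>-3\<close>, \<open>2 \<Delta> - 1\<close>, \<open>3 \<Delta>\<close> to \<open>(\<Delta> + 1) f(V) - (2 - \<Delta>) n\<close>, which is
  therefore at least \<open>3 (\<Delta> |P| - |M|) \<ge> 0\<close>.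
\<close>

lemma (in fin_digraph) out_degree_le_max_degree:
  assumes "v \<in> verts G"
  shows "out_degree G v \<le> max_degree G"
  using assms unfolding max_degree_def by simp

text \<open>\<open>out_degree\<close> counts arcs, and neighbours are their heads; parallel arcs
  could only make the inequality strict.\<close>

lemma (in fin_digraph) card_out_neighbours_le_out_degree:
  "card {u. v \<rightarrow>\<^bsub>G\<^esub> u} \<le> out_degree G v"
proof -
  have "{u. v \<rightarrow>\<^bsub>G\<^esub> u} = head G ` out_arcs G v"
    by (auto simp: arcs_ends_conv out_arcs_def)
  then show ?thesis
    by (simp add: out_degree_def out_arcs_def card_image_le)
qed

text \<open>Union bound: the neighbourhoods of the vertices in \<open>?P\<close> cover
  \<open>?M\<close>, and each has at most \<open>max_degree G\<close> elements.\<close>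

lemma (in graph) MRDF_card_neg_le:
  assumes "MRDF G f"
  shows "card {v \<in> verts G. f v = -1} \<le> max_degree G * card {v \<in> verts G. f v = 2}"
    (is "card ?M \<le> _ * card ?P")
proof -
  have "?M \<subseteq> (\<Union>w\<in>?P. {u. w \<rightarrow>\<^bsub>G\<^esub> u})"
  proof
    fix u assume "u \<in> ?M"
    then obtain w where w: "u \<rightarrow>\<^bsub>G\<^esub> w" "f w = 2"
      using assms unfolding MRDF_def by auto
    \<comment> \<open>Symmetry reverses the arc, since the cover uses out-neighbours of
      \<open>w\<close>.\<close>
    then have "w \<in> verts G" and "w \<rightarrow>\<^bsub>G\<^esub> u"
      by (auto intro: arcs_ends_symmetric[OF sym_arcs])
    with w show "u \<in> (\<Union>w\<in>?P. {u. w \<rightarrow>\<^bsub>G\<^esub> u})" by blast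
  qed
  moreover have "finite (\<Union>w\<in>?P. {u. w \<rightarrow>\<^bsub>G\<^esub> u})"
    by (rule finite_subset[of _ "verts G"]) (auto dest: adj_in_verts)
  ultimately have "card ?M \<le> card (\<Union>w\<in>?P. {u. w \<rightarrow>\<^bsub>G\<^esub> u})"
    by (rule card_mono[rotated])
  also have "\<dots> \<le> (\<Sum>w\<in>?P. card {u. w \<rightarrow>\<^bsub>G\<^esub> u})"
    by (rule card_UN_le) simp
  also have "\<dots> \<le> of_nat (card ?P) * max_degree G"
    by (rule sum_bounded_above)
      (auto intro: order_trans[OF card_out_neighbours_le_out_degree out_degree_le_max_degree])
  finally show ?thesis by (simp add: mult.commute)
qed

lemma (in graph) MRDF_weight_ge:
  assumes "MRDF G f" and "max_degree G \<ge> 1"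
  shows "int (card (verts G)) * (2 - int (max_degree G)) \<le> sum f (verts G) * (int (max_degree G) + 1)"
proof -
  let ?D = "int (max_degree G)"
  let ?M = "{v \<in> verts G. f v = -1}" and ?P = "{v \<in> verts G. f v = 2}"
  \<comment> \<open>Equality holds for the values -1 and 2; for the value 1 this is
    \<open>0 \<le> 2 * ?D - 1\<close>, which is where \<Delta> \<ge> 1 enters.\<close>
  have "3 * ?D * of_bool (f v = 2) - 3 * of_bool (f v = -1) \<le> f v * (?D + 1) - (2 - ?D)"
    if "v \<in> verts G" for v
    using assms that unfolding MRDF_def by fastforce
  then have "(\<Sum>v\<in>verts G. 3 * ?D * of_bool (f v = 2) - 3 * of_bool (f v = -1))
      \<le> (\<Sum>v\<in>verts G. f v * (?D + 1) - (2 - ?D))"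
    by (rule sum_mono)
  also have "\<dots> = sum f (verts G) * (?D + 1) - int (card (verts G)) * (2 - ?D)"
    by (simp add: sum_subtractf sum_distrib_right)
  also have "(\<Sum>v\<in>verts G. 3 * ?D * of_bool (f v = 2) - 3 * of_bool (f v = -1))
      = 3 * ?D * int (card ?P) - 3 * int (card ?M)"
    by (simp add: sum_subtractf flip: sum_distrib_left) (simp add: Int_def)
  finally have "3 * ?D * int (card ?P) - 3 * int (card ?M)
      \<le> sum f (verts G) * (?D + 1) - int (card (verts G)) * (2 - ?D)" .
  moreover have "int (card ?M) \<le> ?D * int (card ?P)"
    using MRDF_card_neg_le[OF assms(1)] by (simp flip: of_nat_mult)
  ultimately show ?thesis by simp
qed

theorem theorem14:
  fixes G :: "('a, 'b) pre_digraph" and n \<Delta> :: nat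
  assumes "graph G"
    and "n = card (verts G)" and "n \<ge> 2"
    and "\<Delta> = max_degree G" and "\<Delta> \<ge> 1"
  shows "real_of_int (gamma_MR G) \<ge> real n * (2 - real \<Delta>) / (real \<Delta> + 1)"
proof -
  interpret graph G by fact
  \<comment> \<open>The minimum is attained, so the bound for a single MRDF applies to a
    minimiser.\<close>
  have "gamma_MR G \<in> MRDF_weights G"
    unfolding gamma_MR_def
    by (intro Min_in finite_MRDF_weights MRDF_weights_nonempty assms) simp
  then obtain f where f: "MRDF G f" "gamma_MR G = sum f (verts G)"
    unfolding MRDF_weights_def by blast
  then have "int n * (2 - int \<Delta>) \<le> gamma_MR G * (int \<Delta> + 1)"
    using MRDF_weight_ge[OF f(1)] assms by simp
  then have "real_of_int (int n * (2 - int \<Delta>)) \<le> real_of_int (gamma_MR G * (int \<Delta> + 1))"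
    by (simp only: of_int_le_iff)
  then show ?thesis by (simp add: divide_le_eq)
qed

end
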